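(* Let $(X,*,\mathtt{u}_X,\mathtt{d}_X)$ be a $\mathrm{GL}$-rack. Then the category $\mathbf{GLMod}_{(X,*,\mathtt{u}_X,\mathtt{d}_X)}$ of $(X,*,\mathtt{u}_X,\mathtt{d}_X)$-modules is equivalent to the category $\mathbf{Ab}(\mathbf{GL}|_{(X,*,\mathtt{u}_X,\mathtt{d}_X)})$ of abelian group objects in the slice category of $\mathrm{GL}$-racks over $(X,*,\mathtt{u}_X,\mathtt{d}_X)$.
   Context: A rack $(X,* )$ is a set with a binary operation such that for all $x,y\in X$ there is a unique $z$ with $z*y=x$, and $(x*y)*z=(x*z)*(y*z)$ for all $x,y,z$. A $\mathrm{GL}$-rack is a quadruple $(X,*,\mathtt{u}_X,\mathtt{d}_X)$ with $(X,* )$ a rack and maps $\mathtt{u}_X,\mathtt{d}_X:X\to X$ such that for all $x,y\in X$: $\mathtt{u}_X\mathtt{d}_X(x*x)=x=\mathtt{d}_X\mathtt{u}_X(x*x)$; $\mathtt{u}_X(x*y)=\mathtt{u}_X(x)*y$; $\mathtt{d}_X(x*y)=\mathtt{d}_X(x)*y$; $x*\mathtt{u}_X(y)=x*y$; $x*\mathtt{d}_X(y)=x*y$. $\mathrm{GL}$-rack homomorphisms are maps preserving $*$ and commuting with the $\mathtt{u}$'s and $\mathtt{d}$'s; $\mathbf{GL}$ is the resulting category. $\mathbf{GL}|_X$ is the slice category over $X$; it has finite products, given by fibre products $Y\times_XZ$ with componentwise structure, so one can speak of abelian group objects in it. A morphism of abelian group objects is a slice morphism $f$ compatible with multiplications,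 $f m_1=m_2(f\times f)$. An $(X,*,\mathtt{u}_X,\mathtt{d}_X)$-module $\mathscr{F}=(A,\phi,\psi,\zeta,\Omega)$ consists of abelian groups $A_x$ ($x\in X$) and group homomorphisms $\phi_{x,y}:A_x\to A_{x*y}$, $\psi_{x,y}:A_y\to A_{x*y}$, $\zeta_x:A_x\to A_{\mathtt{u}_X(x)}$, $\Omega_x:A_x\to A_{\mathtt{d}_X(x)}$ for all $x,y\in X$, with every $\phi_{x,y}$ an isomorphism, such that for all $x,y,z\in X$: (M1) $\phi_{x*y,z}\phi_{x,y}=\phi_{x*z,y*z}\phi_{x,z}$; (M2) $\phi_{x*y,z}\psi_{x,y}=\psi_{x*z,y*z}\phi_{y,z}$; (M3) $\zeta_{x*y}\phi_{x,y}=\phi_{\mathtt{u}_X(x),y}\zeta_x$; (M4) $\Omega_{x*y}\phi_{x,y}=\phi_{\mathtt{d}_X(x),y}\Omega_x$; (M5) $\phi_{x,\mathtt{u}_X(y)}=\phi_{x,y}$; (M6) $\phi_{x,\mathtt{d}_X(y)}=\phi_{x,y}$; (M7) $\psi_{\mathtt{u}_X(x),y}=\zeta_{x*y}\psi_{x,y}$; (M8) $\psi_{\mathtt{d}_X(x),y}=\Omega_{x*y}\psi_{x,y}$; (M9) $\psi_{x,\mathtt{u}_X(y)}\zeta_y=\psi_{x,y}$; (M10) $\psi_{x,\mathtt{d}_X(y)}\Omega_y=\psi_{x,y}$; (M11) $\psi_{x*y,z}(a)=\phi_{x*z,y*z}\psi_{x,z}(a)+\psi_{x*z,y*z}\psi_{y,z}(a)$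 for $a\in A_z$; (M12) $\zeta_{\mathtt{d}_X(x*x)}(\Omega_{x*x}(\phi_{x,x}(b)+\psi_{x,x}(b)))=b$ for $b\in A_x$; (M13) $\Omega_{\mathtt{u}_X(x*x)}(\zeta_{x*x}(\phi_{x,x}(b)+\psi_{x,x}(b)))=b$ for $b\in A_x$. A morphism ($(X,*,\mathtt{u}_X,\mathtt{d}_X)$-map) $f:(A,\phi,\psi,\zeta,\Omega)\to(A',\phi',\psi',\zeta',\Omega')$ is a family of group homomorphisms $f_x:A_x\to A'_x$ with $\phi'_{x,y}f_x=f_{x*y}\phi_{x,y}$, $\psi'_{x,y}f_y=f_{x*y}\psi_{x,y}$, $\zeta'_xf_x=f_{\mathtt{u}_X(x)}\zeta_x$, $\Omega'_xf_x=f_{\mathtt{d}_X(x)}\Omega_x$ for all $x,y\in X$. These form the category $\mathbf{GLMod}_{(X,*,\mathtt{u}_X,\mathtt{d}_X)}$. *)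

theory Defs
  imports "HOL-Algebra.Group" "HOL-Library.Equipollence"
begin

section \<open>Categories, functors, equivalences\<close>

text \<open>
  Hom-sets of distinct pairs of objects need not be disjoint, so identities and composition
  carry their objects as arguments: \<open>Comp C a b c g f\<close> is the composite of
  \<open>f : a \<rightarrow> b\<close> and \<open>g : b \<rightarrow> c\<close>.
\<close>

record ('o, 'm) category =
  Obj :: "'o set"
  Hom :: "'o \<Rightarrow> 'o \<Rightarrow> 'm set"
  Id :: "'o \<Rightarrow> 'm"
  Comp :: "'o \<Rightarrow> 'o \<Rightarrow> 'o \<Rightarrow> 'm \<Rightarrow> 'm \<Rightarrow> 'm"

definition is_category :: "('o, 'm) category \<Rightarrow> bool" where
  "is_category C \<longleftrightarrow>
     (\<forall>a \<in> Obj C. Id C a \<in> Hom C a a) \<and>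
     (\<forall>a \<in> Obj C. \<forall>b \<in> Obj C. \<forall>c \<in> Obj C. \<forall>f \<in> Hom C a b. \<forall>g \<in> Hom C b c.
        Comp C a b c g f \<in> Hom C a c) \<and>
     (\<forall>a \<in> Obj C. \<forall>b \<in> Obj C. \<forall>f \<in> Hom C a b.
        Comp C a b b (Id C b) f = f \<and> Comp C a a b f (Id C a) = f) \<and>
     (\<forall>a \<in> Obj C. \<forall>b \<in> Obj C. \<forall>c \<in> Obj C. \<forall>d \<in> Obj C.
        \<forall>f \<in> Hom C a b. \<forall>g \<in> Hom C b c. \<forall>h \<in> Hom C c d.
        Comp C a c d h (Comp C a b c g f) = Comp C a b d (Comp C b c d h g) f)"

record ('o1, 'm1, 'o2, 'm2) functr =
  on_obj :: "'o1 \<Rightarrow> 'o2"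
  on_hom :: "'o1 \<Rightarrow> 'o1 \<Rightarrow> 'm1 \<Rightarrow> 'm2"

definition is_functor ::
    "('o1, 'm1) category \<Rightarrow> ('o2, 'm2) category \<Rightarrow> ('o1, 'm1, 'o2, 'm2) functr \<Rightarrow> bool" where
  "is_functor C D F \<longleftrightarrow>
     (\<forall>a \<in> Obj C. on_obj F a \<in> Obj D) \<and>
     (\<forall>a \<in> Obj C. \<forall>b \<in> Obj C. \<forall>f \<in> Hom C a b.
        on_hom F a b f \<in> Hom D (on_obj F a) (on_obj F b)) \<and>
     (\<forall>a \<in> Obj C. on_hom F a a (Id C a) = Id D (on_obj F a)) \<and>
     (\<forall>a \<in> Obj C. \<forall>b \<in> Obj C. \<forall>c \<in> Obj C. \<forall>f \<in> Hom C a b. \<forall>g \<in> Hom C b c.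
        on_hom F a c (Comp C a b c g f) =
        Comp D (on_obj F a) (on_obj F b) (on_obj F c) (on_hom F b c g) (on_hom F a b f))"

definition id_functor :: "('o, 'm, 'o, 'm) functr" where
  "id_functor = \<lparr>on_obj = (\<lambda>a. a), on_hom = (\<lambda>a b f. f)\<rparr>"

definition comp_functor ::
    "('o2, 'm2, 'o3, 'm3) functr \<Rightarrow> ('o1, 'm1, 'o2, 'm2) functr \<Rightarrow> ('o1, 'm1, 'o3, 'm3) functr" where
  "comp_functor G F =
     \<lparr>on_obj = (\<lambda>a. on_obj G (on_obj F a)),
      on_hom = (\<lambda>a b f. on_hom G (on_obj F a) (on_obj F b) (on_hom F a b f))\<rparr>"

definition isomorphism :: "('o, 'm) category \<Rightarrow> 'o \<Rightarrow> 'o \<Rightarrow> 'm \<Rightarrow> bool" where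
  "isomorphism C a b f \<longleftrightarrow>
     f \<in> Hom C a b \<and>
     (\<exists>g \<in> Hom C b a. Comp C a b a g f = Id C a \<and> Comp C b a b f g = Id C b)"

definition natural_isomorphism ::
    "('o1, 'm1) category \<Rightarrow> ('o2, 'm2) category \<Rightarrow>
     ('o1, 'm1, 'o2, 'm2) functr \<Rightarrow> ('o1, 'm1, 'o2, 'm2) functr \<Rightarrow> ('o1 \<Rightarrow> 'm2) \<Rightarrow> bool" where
  "natural_isomorphism C D F G \<eta> \<longleftrightarrow>
     (\<forall>a \<in> Obj C. isomorphism D (on_obj F a) (on_obj G a) (\<eta> a)) \<and>
     (\<forall>a \<in> Obj C. \<forall>b \<in> Obj C. \<forall>f \<in> Hom C a b.
        Comp D (on_obj F a) (on_obj F b) (on_obj G b) (\<eta> b) (on_hom F a b f) =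
        Comp D (on_obj F a) (on_obj G a) (on_obj G b) (on_hom G a b f) (\<eta> a))"

definition equivalent_categories :: "('o1, 'm1) category \<Rightarrow> ('o2, 'm2) category \<Rightarrow> bool" where
  "equivalent_categories C D \<longleftrightarrow>
     is_category C \<and> is_category D \<and>
     (\<exists>F G \<eta> \<epsilon>. is_functor C D F \<and> is_functor D C G \<and>
        natural_isomorphism C C id_functor (comp_functor G F) \<eta> \<and>
        natural_isomorphism D D (comp_functor F G) id_functor \<epsilon>)"


section \<open>GL-racks\<close>

record 'a gl_rack = "'a partial_object" +
  rack_op :: "'a \<Rightarrow> 'a \<Rightarrow> 'a" (infixl \<open>\<star>\<index>\<close> 70)
  up :: "'a \<Rightarrow> 'a" (\<open>\<u>\<index>\<close>)
  down :: "'a \<Rightarrow> 'a" (\<open>\<d>\<index>\<close>)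

locale rack =
  fixes X :: "('a, 'r) gl_rack_scheme" (structure)
  assumes op_closed: "\<lbrakk>x \<in> carrier X; y \<in> carrier X\<rbrakk> \<Longrightarrow> x \<star> y \<in> carrier X"
    and op_divisible: "\<lbrakk>x \<in> carrier X; y \<in> carrier X\<rbrakk> \<Longrightarrow> \<exists>!z. z \<in> carrier X \<and> z \<star> y = x"
    and op_distrib: "\<lbrakk>x \<in> carrier X; y \<in> carrier X; z \<in> carrier X\<rbrakk> \<Longrightarrow>
                       (x \<star> y) \<star> z = (x \<star> z) \<star> (y \<star> z)"

locale GL_rack = rack X for X :: "('a, 'r) gl_rack_scheme" (structure) +
  assumes u_closed: "x \<in> carrier X \<Longrightarrow> \<u> x \<in> carrier X"
    and d_closed: "x \<in> carrier X \<Longrightarrow> \<d> x \<in> carrier X"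
    and ud_square: "x \<in> carrier X \<Longrightarrow> \<u> (\<d> (x \<star> x)) = x"
    and du_square: "x \<in> carrier X \<Longrightarrow> \<d> (\<u> (x \<star> x)) = x"
    and u_op: "\<lbrakk>x \<in> carrier X; y \<in> carrier X\<rbrakk> \<Longrightarrow> \<u> (x \<star> y) = \<u> x \<star> y"
    and d_op: "\<lbrakk>x \<in> carrier X; y \<in> carrier X\<rbrakk> \<Longrightarrow> \<d> (x \<star> y) = \<d> x \<star> y"
    and op_u: "\<lbrakk>x \<in> carrier X; y \<in> carrier X\<rbrakk> \<Longrightarrow> x \<star> \<u> y = x \<star> y"
    and op_d: "\<lbrakk>x \<in> carrier X; y \<in> carrier X\<rbrakk> \<Longrightarrow> x \<star> \<d> y = x \<star> y"

text \<open>
  Morphisms are maps that are \<^const>\<open>undefined\<close> off the carrier, so that equality in HOL is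
  equality of morphisms.
\<close>

definition GL_hom :: "'a gl_rack \<Rightarrow> 'b gl_rack \<Rightarrow> ('a \<Rightarrow> 'b) set" where
  "GL_hom Y Z =
     {f \<in> carrier Y \<rightarrow>\<^sub>E carrier Z.
        (\<forall>x \<in> carrier Y. \<forall>y \<in> carrier Y. f (x \<star>\<^bsub>Y\<^esub> y) = f x \<star>\<^bsub>Z\<^esub> f y) \<and>
        (\<forall>x \<in> carrier Y. f (\<u>\<^bsub>Y\<^esub> x) = \<u>\<^bsub>Z\<^esub> (f x)) \<and>
        (\<forall>x \<in> carrier Y. f (\<d>\<^bsub>Y\<^esub> x) = \<d>\<^bsub>Z\<^esub> (f x))}"


section \<open>The slice over a GL-rack and its abelian group objects\<close>

record ('y, 'x) gl_over =
  total :: "'y gl_rack"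
  proj :: "'y \<Rightarrow> 'x"

definition slice_obj :: "'x gl_rack \<Rightarrow> ('y, 'x) gl_over set" where
  "slice_obj X = {S. GL_rack (total S) \<and> proj S \<in> GL_hom (total S) X}"

definition slice_hom :: "('y, 'x) gl_over \<Rightarrow> ('z, 'x) gl_over \<Rightarrow> ('y \<Rightarrow> 'z) set" where
  "slice_hom S T =
     {f \<in> GL_hom (total S) (total T). \<forall>y \<in> carrier (total S). proj T (f y) = proj S y}"

definition slice_terminal :: "'x gl_rack \<Rightarrow> ('x, 'x) gl_over" where
  "slice_terminal X = \<lparr>total = X, proj = (\<lambda>x \<in> carrier X. x)\<rparr>"

definition fibre_carrier :: "('y, 'x) gl_over \<Rightarrow> ('z, 'x) gl_over \<Rightarrow> ('y \<times> 'z) set" where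
  "fibre_carrier S T =
     {(y, z). y \<in> carrier (total S) \<and> z \<in> carrier (total T) \<and> proj S y = proj T z}"

definition fibre_product ::
    "('y, 'x) gl_over \<Rightarrow> ('z, 'x) gl_over \<Rightarrow> ('y \<times> 'z, 'x) gl_over" (infixl \<open>\<times>\<^sub>X\<close> 75) where
  "S \<times>\<^sub>X T =
     \<lparr>total =
        \<lparr>carrier = fibre_carrier S T,
         rack_op = (\<lambda>(y, z) (y', z'). (y \<star>\<^bsub>total S\<^esub> y', z \<star>\<^bsub>total T\<^esub> z')),
         up = (\<lambda>(y, z). (\<u>\<^bsub>total S\<^esub> y, \<u>\<^bsub>total T\<^esub> z)),
         down = (\<lambda>(y, z). (\<d>\<^bsub>total S\<^esub> y, \<d>\<^bsub>total T\<^esub> z))\<rparr>,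
      proj = (\<lambda>(y, z) \<in> fibre_carrier S T. proj S y)\<rparr>"

text \<open>
  The componentwise structure makes the fibre product a product in the slice, and \<open>X\<close> over
  itself is terminal.
\<close>

lemma GL_homI:
  assumes "\<And>x. x \<in> carrier Y \<Longrightarrow> f x \<in> carrier Z" "f \<in> extensional (carrier Y)"
    "\<And>x y. \<lbrakk>x \<in> carrier Y; y \<in> carrier Y\<rbrakk> \<Longrightarrow> f (x \<star>\<^bsub>Y\<^esub> y) = f x \<star>\<^bsub>Z\<^esub> f y"
    "\<And>x. x \<in> carrier Y \<Longrightarrow> f (\<u>\<^bsub>Y\<^esub> x) = \<u>\<^bsub>Z\<^esub> (f x)"
    "\<And>x. x \<in> carrier Y \<Longrightarrow> f (\<d>\<^bsub>Y\<^esub> x) = \<d>\<^bsub>Z\<^esub> (f x)"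
  shows "f \<in> GL_hom Y Z"
  using assms by (simp add: GL_hom_def PiE_def Pi_def)

lemma GL_homD:
  assumes "f \<in> GL_hom Y Z"
  shows "x \<in> carrier Y \<Longrightarrow> f x \<in> carrier Z" "f \<in> extensional (carrier Y)"
    "\<lbrakk>x \<in> carrier Y; y \<in> carrier Y\<rbrakk> \<Longrightarrow> f (x \<star>\<^bsub>Y\<^esub> y) = f x \<star>\<^bsub>Z\<^esub> f y"
    "x \<in> carrier Y \<Longrightarrow> f (\<u>\<^bsub>Y\<^esub> x) = \<u>\<^bsub>Z\<^esub> (f x)"
    "x \<in> carrier Y \<Longrightarrow> f (\<d>\<^bsub>Y\<^esub> x) = \<d>\<^bsub>Z\<^esub> (f x)"
  using assms by (simp_all add: GL_hom_def PiE_def Pi_def)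

lemma slice_terminal_obj:
  assumes "GL_rack X"
  shows "slice_terminal X \<in> slice_obj X"
proof -
  interpret GL_rack X by fact
  show ?thesis
    using assms
    by (simp add: slice_terminal_def slice_obj_def GL_homI op_closed u_closed d_closed)
qed

lemma slice_terminal_hom:
  assumes "S \<in> slice_obj X"
  shows "slice_hom S (slice_terminal X) = {proj S}"
proof -
  have p: "proj S \<in> GL_hom (total S) X"
    using assms by (simp add: slice_obj_def)
  have "f = proj S" if "f \<in> slice_hom S (slice_terminal X)" for f
  proof (rule extensionalityI[where A = "carrier (total S)"])
    have f: "f \<in> GL_hom (total S) X"
      using that by (simp add: slice_hom_def slice_terminal_def)
    show "f \<in> extensional (carrier (total S))" "proj S \<in> extensional (carrier (total S))"
      by (fact GL_homD[OF f] GL_homD[OF p])+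
    show "f y = proj S y" if y: "y \<in> carrier (total S)" for y
    proof -
      have "proj (slice_terminal X) (f y) = proj S y"
        using \<open>f \<in> slice_hom S (slice_terminal X)\<close> y by (simp add: slice_hom_def)
      then show ?thesis
        using GL_homD(1)[OF f y] by (simp add: slice_terminal_def)
    qed
  qed
  moreover have "proj S \<in> slice_hom S (slice_terminal X)"
    using p GL_homD(1)[OF p] by (simp add: slice_hom_def slice_terminal_def)
  ultimately show ?thesis by blast
qed

lemma fibre_product_obj:
  assumes X: "GL_rack X" and S: "S \<in> slice_obj X" and T: "T \<in> slice_obj X"
  shows "S \<times>\<^sub>X T \<in> slice_obj X"
proof -
  interpret X: GL_rack X by fact
  interpret S: GL_rack "total S" using S by (simp add: slice_obj_def)
  interpret T: GL_rack "total T" using T by (simp add: slice_obj_def)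
  have pS: "proj S \<in> GL_hom (total S) X" and pT: "proj T \<in> GL_hom (total T) X"
    using S T by (simp_all add: slice_obj_def)
  note pS = GL_homD[OF pS] and pT = GL_homD[OF pT]
  note closed = S.op_closed T.op_closed S.u_closed T.u_closed S.d_closed T.d_closed
  have div: "\<exists>!z. z \<in> fibre_carrier S T \<and>
               fst z \<star>\<^bsub>total S\<^esub> fst v = fst w \<and> snd z \<star>\<^bsub>total T\<^esub> snd v = snd w"
    if "w \<in> fibre_carrier S T" "v \<in> fibre_carrier S T" for w v
  proof -
    obtain a b c d where wv: "w = (a, b)" "v = (c, d)"
      by (cases w, cases v) simp
    have m: "a \<in> carrier (total S)" "b \<in> carrier (total T)" "proj S a = proj T b"
      "c \<in> carrier (total S)" "d \<in> carrier (total T)" "proj S c = proj T d"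
      using that by (simp_all add: wv fibre_carrier_def)
    obtain s where s: "s \<in> carrier (total S)" "s \<star>\<^bsub>total S\<^esub> c = a"
      using S.op_divisible[of a c] m by blast
    obtain t where t: "t \<in> carrier (total T)" "t \<star>\<^bsub>total T\<^esub> d = b"
      using T.op_divisible[of b d] m by blast
    have "proj S s \<star>\<^bsub>X\<^esub> proj S c = proj S a" "proj T t \<star>\<^bsub>X\<^esub> proj S c = proj S a"
      using s t m pS(3)[of s c] pT(3)[of t d] by simp_all
    then have "proj S s = proj T t"
      using X.op_divisible[of "proj S a" "proj S c"] pS(1) pT(1) s(1) t(1) m(1,4) by blast
    moreover have "z = (s, t)"
      if "z \<in> fibre_carrier S T" "fst z \<star>\<^bsub>total S\<^esub> c = a" "snd z \<star>\<^bsub>total T\<^esub> d = b" for z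
    proof -
      have "fst z \<in> carrier (total S)" "snd z \<in> carrier (total T)"
        using that(1) by (auto simp: fibre_carrier_def)
      then have "fst z = s" "snd z = t"
        using S.op_divisible[of a c] T.op_divisible[of b d] that(2,3) s t m by blast+
      then show ?thesis by (simp add: prod_eq_iff)
    qed
    ultimately show ?thesis
      using s t by (intro ex1I[of _ "(s, t)"]) (simp_all add: wv fibre_carrier_def)
  qed
  have "GL_rack (total (S \<times>\<^sub>X T))"
  proof (unfold_locales, goal_cases)
    case (2 w v)
    then show ?case
      using div[of w v] by (simp add: fibre_product_def split_beta prod_eq_iff)
  next
    case 6
    then show ?case
      by (simp add: fibre_product_def fibre_carrier_def split_beta S.ud_square T.ud_square)
  next
    case 7
    then show ?case
      by (simp add: fibre_product_def fibre_carrier_def split_beta S.du_square T.du_square)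
  qed (simp_all add: fibre_product_def fibre_carrier_def split_beta prod_eq_iff pS pT closed
      S.op_distrib[symmetric] T.op_distrib[symmetric] S.u_op T.u_op S.d_op T.d_op S.op_u T.op_u S.op_d T.op_d)
  moreover have "proj (S \<times>\<^sub>X T) \<in> GL_hom (total (S \<times>\<^sub>X T)) X"
    by (rule GL_homI)
       (simp_all add: fibre_product_def fibre_carrier_def split_beta pS pT closed)
  ultimately show ?thesis by (simp add: slice_obj_def)
qed

lemma fibre_product_projections:
  assumes S: "S \<in> slice_obj X" and T: "T \<in> slice_obj X"
  shows "restrict fst (fibre_carrier S T) \<in> slice_hom (S \<times>\<^sub>X T) S"
    and "restrict snd (fibre_carrier S T) \<in> slice_hom (S \<times>\<^sub>X T) T"
proof -
  interpret S: GL_rack "total S" using S by (simp add: slice_obj_def)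
  interpret T: GL_rack "total T" using T by (simp add: slice_obj_def)
  have pS: "proj S \<in> GL_hom (total S) X" and pT: "proj T \<in> GL_hom (total T) X"
    using S T by (simp_all add: slice_obj_def)
  note simps = GL_homD(3-5)[OF pS] GL_homD(3-5)[OF pT]
    S.op_closed T.op_closed S.u_closed T.u_closed S.d_closed T.d_closed
  show "restrict fst (fibre_carrier S T) \<in> slice_hom (S \<times>\<^sub>X T) S"
    unfolding slice_hom_def
    by (rule CollectI, rule conjI, rule GL_homI)
       (simp_all add: fibre_product_def fibre_carrier_def split_beta simps)
  show "restrict snd (fibre_carrier S T) \<in> slice_hom (S \<times>\<^sub>X T) T"
    unfolding slice_hom_def
    by (rule CollectI, rule conjI, rule GL_homI)
       (simp_all add: fibre_product_def fibre_carrier_def split_beta simps)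
qed

lemma fibre_product_universal:
  assumes W: "W \<in> slice_obj X" and f: "f \<in> slice_hom W S" and g: "g \<in> slice_hom W T"
  shows "\<exists>!h. h \<in> slice_hom W (S \<times>\<^sub>X T) \<and>
              (\<forall>w \<in> carrier (total W). fst (h w) = f w \<and> snd (h w) = g w)"
proof (rule ex1I[of _ "\<lambda>w \<in> carrier (total W). (f w, g w)"], goal_cases)
  case 1
  interpret W: GL_rack "total W" using W by (simp add: slice_obj_def)
  have fg: "f \<in> GL_hom (total W) (total S)" "g \<in> GL_hom (total W) (total T)"
    "w \<in> carrier (total W) \<Longrightarrow> proj S (f w) = proj W w"
    "w \<in> carrier (total W) \<Longrightarrow> proj T (g w) = proj W w" for w
    using f g by (simp_all add: slice_hom_def)
  note simps = fg(3,4) GL_homD[OF fg(1)] GL_homD[OF fg(2)] W.op_closed W.u_closed W.d_closed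
  have "(\<lambda>w \<in> carrier (total W). (f w, g w)) \<in> GL_hom (total W) (total (S \<times>\<^sub>X T))"
    by (rule GL_homI) (simp_all add: fibre_product_def fibre_carrier_def simps)
  then show ?case
    by (simp add: slice_hom_def fibre_product_def fibre_carrier_def simps)
next
  case (2 h)
  then have "h \<in> extensional (carrier (total W))"
    by (auto simp: slice_hom_def dest: GL_homD(2))
  with 2 show ?case
    by (intro extensionalityI[where A = "carrier (total W)"]) (simp_all add: prod_eq_iff)
qed

text \<open>
  An abelian group object \<open>S\<close> has structure morphisms \<open>S \<times>\<^sub>X S \<rightarrow> S\<close>, \<open>1 \<rightarrow> S\<close> and
  \<open>S \<rightarrow> S\<close> of the slice, the terminal object \<open>1\<close> being \<open>X\<close> over itself.  The commuting
  diagrams are written out as equalities of maps.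
\<close>

record ('y, 'x) gl_ab =
  ob :: "('y, 'x) gl_over"
  mu :: "'y \<times> 'y \<Rightarrow> 'y"
  unit :: "'x \<Rightarrow> 'y"
  neg :: "'y \<Rightarrow> 'y"

definition ab_obj :: "'x gl_rack \<Rightarrow> ('y, 'x) gl_ab set" where
  "ab_obj X =
     {G. ob G \<in> slice_obj X \<and>
         mu G \<in> slice_hom (ob G \<times>\<^sub>X ob G) (ob G) \<and>
         unit G \<in> slice_hom (slice_terminal X) (ob G) \<and>
         neg G \<in> slice_hom (ob G) (ob G) \<and>
         (\<forall>((a, b), c) \<in> carrier (total (ob G \<times>\<^sub>X ob G \<times>\<^sub>X ob G)).
            mu G (mu G (a, b), c) = mu G (a, mu G (b, c))) \<and>
         (\<forall>a \<in> carrier (total (ob G)).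
            mu G (unit G (proj (ob G) a), a) = a \<and> mu G (a, unit G (proj (ob G) a)) = a) \<and>
         (\<forall>a \<in> carrier (total (ob G)).
            mu G (neg G a, a) = unit G (proj (ob G) a) \<and>
            mu G (a, neg G a) = unit G (proj (ob G) a)) \<and>
         (\<forall>(a, b) \<in> carrier (total (ob G \<times>\<^sub>X ob G)). mu G (a, b) = mu G (b, a))}"

definition ab_hom :: "('y, 'x) gl_ab \<Rightarrow> ('y, 'x) gl_ab \<Rightarrow> ('y \<Rightarrow> 'y) set" where
  "ab_hom G H =
     {f \<in> slice_hom (ob G) (ob H).
        \<forall>(a, b) \<in> carrier (total (ob G \<times>\<^sub>X ob G)). f (mu G (a, b)) = mu H (f a, f b)}"

text \<open>
  The type \<open>'y\<close> plays the role of the universe: the objects are those whose underlying set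
  consists of elements of \<open>'y\<close>.  Likewise for \<open>'a\<close> in \<open>GLMod\<close> below.
\<close>

definition Ab_slice :: "'x gl_rack \<Rightarrow> (('y, 'x) gl_ab, 'y \<Rightarrow> 'y) category" where
  "Ab_slice X =
     \<lparr>Obj = ab_obj X,
      Hom = ab_hom,
      Id = (\<lambda>G. \<lambda>a \<in> carrier (total (ob G)). a),
      Comp = (\<lambda>G H K g f. compose (carrier (total (ob G))) g f)\<rparr>"


section \<open>Modules over a GL-rack\<close>

text \<open>
  The abelian groups are written multiplicatively, following \<^theory>\<open>HOL-Algebra.Group\<close>.
\<close>

record ('x, 'a) gl_module =
  grp :: "'x \<Rightarrow> 'a monoid"
  phi :: "'x \<Rightarrow> 'x \<Rightarrow> 'a \<Rightarrow> 'a"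
  psi :: "'x \<Rightarrow> 'x \<Rightarrow> 'a \<Rightarrow> 'a"
  zeta :: "'x \<Rightarrow> 'a \<Rightarrow> 'a"
  Omega :: "'x \<Rightarrow> 'a \<Rightarrow> 'a"

locale GL_module = GL_rack X for X :: "'x gl_rack" (structure) +
  fixes A :: "'x \<Rightarrow> 'a monoid"
    and \<phi> \<psi> :: "'x \<Rightarrow> 'x \<Rightarrow> 'a \<Rightarrow> 'a"
    and \<zeta> \<Omega> :: "'x \<Rightarrow> 'a \<Rightarrow> 'a"
  assumes grp: "x \<in> carrier X \<Longrightarrow> comm_group (A x)"
    and phi_iso: "\<lbrakk>x \<in> carrier X; y \<in> carrier X\<rbrakk> \<Longrightarrow> \<phi> x y \<in> iso (A x) (A (x \<star> y))"
    and psi_hom: "\<lbrakk>x \<in> carrier X; y \<in> carrier X\<rbrakk> \<Longrightarrow> \<psi> x y \<in> hom (A y) (A (x \<star> y))"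
    and zeta_hom: "x \<in> carrier X \<Longrightarrow> \<zeta> x \<in> hom (A x) (A (\<u> x))"
    and Omega_hom: "x \<in> carrier X \<Longrightarrow> \<Omega> x \<in> hom (A x) (A (\<d> x))"
    and M1: "\<lbrakk>x \<in> carrier X; y \<in> carrier X; z \<in> carrier X; a \<in> carrier (A x)\<rbrakk> \<Longrightarrow>
               \<phi> (x \<star> y) z (\<phi> x y a) = \<phi> (x \<star> z) (y \<star> z) (\<phi> x z a)"
    and M2: "\<lbrakk>x \<in> carrier X; y \<in> carrier X; z \<in> carrier X; a \<in> carrier (A y)\<rbrakk> \<Longrightarrow>
               \<phi> (x \<star> y) z (\<psi> x y a) = \<psi> (x \<star> z) (y \<star> z) (\<phi> y z a)"
    and M3: "\<lbrakk>x \<in> carrier X; y \<in> carrier X; a \<in> carrier (A x)\<rbrakk> \<Longrightarrow>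
               \<zeta> (x \<star> y) (\<phi> x y a) = \<phi> (\<u> x) y (\<zeta> x a)"
    and M4: "\<lbrakk>x \<in> carrier X; y \<in> carrier X; a \<in> carrier (A x)\<rbrakk> \<Longrightarrow>
               \<Omega> (x \<star> y) (\<phi> x y a) = \<phi> (\<d> x) y (\<Omega> x a)"
    and M5: "\<lbrakk>x \<in> carrier X; y \<in> carrier X; a \<in> carrier (A x)\<rbrakk> \<Longrightarrow> \<phi> x (\<u> y) a = \<phi> x y a"
    and M6: "\<lbrakk>x \<in> carrier X; y \<in> carrier X; a \<in> carrier (A x)\<rbrakk> \<Longrightarrow> \<phi> x (\<d> y) a = \<phi> x y a"
    and M7: "\<lbrakk>x \<in> carrier X; y \<in> carrier X; a \<in> carrier (A y)\<rbrakk> \<Longrightarrow>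
               \<psi> (\<u> x) y a = \<zeta> (x \<star> y) (\<psi> x y a)"
    and M8: "\<lbrakk>x \<in> carrier X; y \<in> carrier X; a \<in> carrier (A y)\<rbrakk> \<Longrightarrow>
               \<psi> (\<d> x) y a = \<Omega> (x \<star> y) (\<psi> x y a)"
    and M9: "\<lbrakk>x \<in> carrier X; y \<in> carrier X; a \<in> carrier (A y)\<rbrakk> \<Longrightarrow>
               \<psi> x (\<u> y) (\<zeta> y a) = \<psi> x y a"
    and M10: "\<lbrakk>x \<in> carrier X; y \<in> carrier X; a \<in> carrier (A y)\<rbrakk> \<Longrightarrow>
               \<psi> x (\<d> y) (\<Omega> y a) = \<psi> x y a"
    and M11: "\<lbrakk>x \<in> carrier X; y \<in> carrier X; z \<in> carrier X; a \<in> carrier (A z)\<rbrakk> \<Longrightarrow>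
               \<psi> (x \<star> y) z a =
               \<phi> (x \<star> z) (y \<star> z) (\<psi> x z a) \<otimes>\<^bsub>A ((x \<star> y) \<star> z)\<^esub> \<psi> (x \<star> z) (y \<star> z) (\<psi> y z a)"
    and M12: "\<lbrakk>x \<in> carrier X; b \<in> carrier (A x)\<rbrakk> \<Longrightarrow>
               \<zeta> (\<d> (x \<star> x)) (\<Omega> (x \<star> x) (\<phi> x x b \<otimes>\<^bsub>A (x \<star> x)\<^esub> \<psi> x x b)) = b"
    and M13: "\<lbrakk>x \<in> carrier X; b \<in> carrier (A x)\<rbrakk> \<Longrightarrow>
               \<Omega> (\<u> (x \<star> x)) (\<zeta> (x \<star> x) (\<phi> x x b \<otimes>\<^bsub>A (x \<star> x)\<^esub> \<psi> x x b)) = b"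

definition module_obj :: "'x gl_rack \<Rightarrow> ('x, 'a) gl_module set" where
  "module_obj X = {M. GL_module X (grp M) (phi M) (psi M) (zeta M) (Omega M)}"

definition module_hom ::
    "'x gl_rack \<Rightarrow> ('x, 'a) gl_module \<Rightarrow> ('x, 'a) gl_module \<Rightarrow> ('x \<Rightarrow> 'a \<Rightarrow> 'a) set" where
  "module_hom X M N =
     {f \<in> (\<Pi>\<^sub>E x \<in> carrier X. hom (grp M x) (grp N x) \<inter> extensional (carrier (grp M x))).
        (\<forall>x \<in> carrier X. \<forall>y \<in> carrier X. \<forall>a \<in> carrier (grp M x).
           phi N x y (f x a) = f (x \<star>\<^bsub>X\<^esub> y) (phi M x y a)) \<and>
        (\<forall>x \<in> carrier X. \<forall>y \<in> carrier X. \<forall>a \<in> carrier (grp M y).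
           psi N x y (f y a) = f (x \<star>\<^bsub>X\<^esub> y) (psi M x y a)) \<and>
        (\<forall>x \<in> carrier X. \<forall>a \<in> carrier (grp M x).
           zeta N x (f x a) = f (\<u>\<^bsub>X\<^esub> x) (zeta M x a)) \<and>
        (\<forall>x \<in> carrier X. \<forall>a \<in> carrier (grp M x).
           Omega N x (f x a) = f (\<d>\<^bsub>X\<^esub> x) (Omega M x a))}"

definition GLMod :: "'x gl_rack \<Rightarrow> (('x, 'a) gl_module, 'x \<Rightarrow> 'a \<Rightarrow> 'a) category" where
  "GLMod X =
     \<lparr>Obj = module_obj X,
      Hom = module_hom X,
      Id = (\<lambda>M. \<lambda>x \<in> carrier X. \<lambda>a \<in> carrier (grp M x). a),
      Comp = (\<lambda>M N P g f. \<lambda>x \<in> carrier X. compose (carrier (grp M x)) (g x) (f x))\<rparr>"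

end

theory Submission
  imports Defs
begin

text \<open>
  A module \<open>M\<close> yields the total space of the pairs \<open>(x, a)\<close> with \<open>a \<in> A\<^sub>x\<close> and the operation
  \<open>(x, a) * (y, b) = (x * y, \<phi> a + \<psi> b)\<close>, an abelian group object by fibrewise addition.
  Conversely the fibres of an abelian group object are abelian groups with \<open>\<phi> a = a * 0\<^sub>y\<close> and
  \<open>\<psi> b = 0\<^sub>x * b\<close>.  The two constructions are inverse up to isomorphism because addition is a
  morphism: \<open>a * b = (a + 0) * (0 + b) = a * 0 + 0 * b\<close>.
\<close>

section \<open>The two categories\<close>

context GL_module
begin

lemma fibre_group:
  assumes "x \<in> carrier X"
  shows "group (A x)" "comm_monoid (A x)" "monoid (A x)"
  using grp[OF assms] by (simp_all add: comm_group_def group_def)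

lemmas A_closed = monoid.m_closed[OF fibre_group(3)] monoid.one_closed[OF fibre_group(3)]
  group.inv_closed[OF fibre_group(1)]

lemmas A_ac = comm_monoid.m_ac[OF fibre_group(2)]

lemma phi_hom: "\<lbrakk>x \<in> carrier X; y \<in> carrier X\<rbrakk> \<Longrightarrow> \<phi> x y \<in> hom (A x) (A (x \<star> y))"
  using phi_iso by (simp add: iso_def)

lemmas map_closed = hom_in_carrier[OF phi_hom] hom_in_carrier[OF psi_hom]
  hom_in_carrier[OF zeta_hom] hom_in_carrier[OF Omega_hom]

lemmas map_mult = hom_mult[OF phi_hom] hom_mult[OF psi_hom]
  hom_mult[OF zeta_hom] hom_mult[OF Omega_hom]

lemma hom_fibre_inv:
  assumes "h \<in> hom (A x) (A y)" "x \<in> carrier X" "y \<in> carrier X" "a \<in> carrier (A x)"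
  shows "h (inv\<^bsub>A x\<^esub> a) = inv\<^bsub>A y\<^esub> (h a)"
  using assms
  by (simp add: group_hom.hom_inv group_hom_def group_hom_axioms_def fibre_group)

lemmas map_one = hom_one[OF phi_hom fibre_group(1) fibre_group(1)[OF op_closed]]
  hom_one[OF psi_hom fibre_group(1) fibre_group(1)[OF op_closed]]
  hom_one[OF zeta_hom fibre_group(1) fibre_group(1)[OF u_closed]]
  hom_one[OF Omega_hom fibre_group(1) fibre_group(1)[OF d_closed]]

lemmas map_inv = hom_fibre_inv[OF phi_hom] hom_fibre_inv[OF psi_hom]
  hom_fibre_inv[OF zeta_hom] hom_fibre_inv[OF Omega_hom]

lemmas rack_closed = op_closed u_closed d_closed

end

section \<open>Module morphisms and the category of modules\<close>

lemma module_homI: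
  assumes "\<And>x a. \<lbrakk>x \<in> carrier X; a \<in> carrier (grp M x)\<rbrakk> \<Longrightarrow> f x a \<in> carrier (grp N x)"
    and "f \<in> extensional (carrier X)"
    and "\<And>x. x \<in> carrier X \<Longrightarrow> f x \<in> extensional (carrier (grp M x))"
    and "\<And>x a b. \<lbrakk>x \<in> carrier X; a \<in> carrier (grp M x); b \<in> carrier (grp M x)\<rbrakk> \<Longrightarrow>
           f x (a \<otimes>\<^bsub>grp M x\<^esub> b) = f x a \<otimes>\<^bsub>grp N x\<^esub> f x b"
    and "\<And>x y a. \<lbrakk>x \<in> carrier X; y \<in> carrier X; a \<in> carrier (grp M x)\<rbrakk> \<Longrightarrow>
           f (x \<star>\<^bsub>X\<^esub> y) (phi M x y a) = phi N x y (f x a)"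
    and "\<And>x y a. \<lbrakk>x \<in> carrier X; y \<in> carrier X; a \<in> carrier (grp M y)\<rbrakk> \<Longrightarrow>
           f (x \<star>\<^bsub>X\<^esub> y) (psi M x y a) = psi N x y (f y a)"
    and "\<And>x a. \<lbrakk>x \<in> carrier X; a \<in> carrier (grp M x)\<rbrakk> \<Longrightarrow>
           f (\<u>\<^bsub>X\<^esub> x) (zeta M x a) = zeta N x (f x a)"
    and "\<And>x a. \<lbrakk>x \<in> carrier X; a \<in> carrier (grp M x)\<rbrakk> \<Longrightarrow>
           f (\<d>\<^bsub>X\<^esub> x) (Omega M x a) = Omega N x (f x a)"
  shows "f \<in> module_hom X M N"
  using assms by (simp add: module_hom_def PiE_def Pi_def hom_def)

lemma module_homD:
  assumes "f \<in> module_hom X M N"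
  shows "\<lbrakk>x \<in> carrier X; a \<in> carrier (grp M x)\<rbrakk> \<Longrightarrow> f x a \<in> carrier (grp N x)"
    and "f \<in> extensional (carrier X)"
    and "x \<in> carrier X \<Longrightarrow> f x \<in> extensional (carrier (grp M x))"
    and "\<lbrakk>x \<in> carrier X; a \<in> carrier (grp M x); b \<in> carrier (grp M x)\<rbrakk> \<Longrightarrow>
           f x (a \<otimes>\<^bsub>grp M x\<^esub> b) = f x a \<otimes>\<^bsub>grp N x\<^esub> f x b"
    and "\<lbrakk>x \<in> carrier X; y \<in> carrier X; a \<in> carrier (grp M x)\<rbrakk> \<Longrightarrow>
           f (x \<star>\<^bsub>X\<^esub> y) (phi M x y a) = phi N x y (f x a)"
    and "\<lbrakk>x \<in> carrier X; y \<in> carrier X; a \<in> carrier (grp M y)\<rbrakk> \<Longrightarrow>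
           f (x \<star>\<^bsub>X\<^esub> y) (psi M x y a) = psi N x y (f y a)"
    and "\<lbrakk>x \<in> carrier X; a \<in> carrier (grp M x)\<rbrakk> \<Longrightarrow>
           f (\<u>\<^bsub>X\<^esub> x) (zeta M x a) = zeta N x (f x a)"
    and "\<lbrakk>x \<in> carrier X; a \<in> carrier (grp M x)\<rbrakk> \<Longrightarrow>
           f (\<d>\<^bsub>X\<^esub> x) (Omega M x a) = Omega N x (f x a)"
  using assms by (auto simp: module_hom_def PiE_def Pi_def hom_def)

lemma module_objD:
  "M \<in> module_obj X \<Longrightarrow> GL_module X (grp M) (phi M) (psi M) (zeta M) (Omega M)"
  by (simp add: module_obj_def)

text \<open>Morphisms are extensional in both layers, the family on \<open>carrier X\<close> and
  each \<open>f x\<close> on its group, so the values on the carriers decide equality.\<close>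

lemma module_hom_eqI:
  assumes "f \<in> module_hom X M N" "g \<in> module_hom X M N"
    and "\<And>x a. \<lbrakk>x \<in> carrier X; a \<in> carrier (grp M x)\<rbrakk> \<Longrightarrow> f x a = g x a"
  shows "f = g"
proof (rule extensionalityI[where A = "carrier X"])
  show "f x = g x" if "x \<in> carrier X" for x
    using module_homD(3)[OF assms(1) that] module_homD(3)[OF assms(2) that] assms(3) that
    by (auto intro: extensionalityI)
qed (use assms module_homD(2) in blast)+

lemma module_hom_id:
  assumes "M \<in> module_obj X"
  shows "(\<lambda>x \<in> carrier X. \<lambda>a \<in> carrier (grp M x). a) \<in> module_hom X M M"
proof -
  interpret GL_module X "grp M" "phi M" "psi M" "zeta M" "Omega M"
    using assms by (rule module_objD)
  show ?thesis
    by (rule module_homI) (simp_all add: A_closed map_closed rack_closed)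
qed

lemma module_hom_comp:
  assumes "M \<in> module_obj X" and f: "f \<in> module_hom X M N" and g: "g \<in> module_hom X N P"
  shows "(\<lambda>x \<in> carrier X. compose (carrier (grp M x)) (g x) (f x)) \<in> module_hom X M P"
proof -
  interpret GL_module X "grp M" "phi M" "psi M" "zeta M" "Omega M"
    using assms(1) by (rule module_objD)
  show ?thesis
    by (rule module_homI)
      (simp_all add: compose_def A_closed map_closed rack_closed module_homD[OF f] module_homD[OF g])
qed

lemma is_category_GLMod: "is_category (GLMod X)"
  unfolding is_category_def GLMod_def
proof (intro conjI ballI, unfold category.simps, goal_cases)
  case (3 M N f)
  then show ?case
    using module_hom_comp[OF 3(1,3) module_hom_id[OF 3(2)]]
    by (intro module_hom_eqI[of _ X M N]) (simp_all add: compose_def module_homD(1))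
next
  case (4 M N f)
  then show ?case
    using module_hom_comp[OF 4(1) module_hom_id[OF 4(1)] 4(3)]
    by (intro module_hom_eqI[of _ X M N]) (simp_all add: compose_def)
next
  case (5 M N P Q f g h)
  show ?case
    by (rule module_hom_eqI[OF module_hom_comp[OF 5(1) module_hom_comp[OF 5(1,5,6)] 5(7)]
          module_hom_comp[OF 5(1,5) module_hom_comp[OF 5(2,6,7)]]])
      (use 5 in \<open>simp_all add: compose_def module_homD(1)[of f]\<close>)
qed (simp_all add: module_hom_id module_hom_comp)

text \<open>The structure is algebraic, so the fibrewise inverse of a bijective morphism is again a
  morphism. For the unit of the equivalence it remains to find a bijective morphism.\<close>

lemma module_isomorphism:
  assumes M: "M \<in> module_obj X" and f: "f \<in> module_hom X M N"
    and bij: "\<And>x. x \<in> carrier X \<Longrightarrow> bij_betw (f x) (carrier (grp M x)) (carrier (grp N x))"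
  shows "isomorphism (GLMod X) M N f"
proof -
  interpret GL_module X "grp M" "phi M" "psi M" "zeta M" "Omega M"
    using M by (rule module_objD)
  note fD = module_homD[OF f]
  define g where
    "g = (\<lambda>x \<in> carrier X. \<lambda>b \<in> carrier (grp N x). inv_into (carrier (grp M x)) (f x) b)"
  have gf: "g x (f x a) = a" if "x \<in> carrier X" "a \<in> carrier (grp M x)" for x a
    using that bij_betw_inv_into_left[OF bij] by (simp add: g_def fD)
  \<comment> \<open>Once every target element is written as \<open>f x a\<close>, each law for
    \<open>g\<close> follows from the same law for \<open>f\<close> and from
    \<open>gf\<close>.\<close>
  have *: "\<exists>a \<in> carrier (grp M x). b = f x a" if "x \<in> carrier X" "b \<in> carrier (grp N x)" for x b
    using that bij[of x] by (auto simp: bij_betw_def)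
  have g: "g \<in> module_hom X N M"
  proof (rule module_homI, goal_cases)
    case (1 x b)
    then show ?case using *[of x b] gf by auto
  next
    case (4 x a b)
    then show ?case using *[of x a] *[of x b] by (auto simp: gf A_closed fD(4)[symmetric])
  next
    case (5 x y b)
    then show ?case using *[of x b]
      by (auto simp: gf map_closed rack_closed fD(5)[symmetric])
  next
    case (6 x y b)
    then show ?case using *[of y b]
      by (auto simp: gf map_closed rack_closed fD(6)[symmetric])
  next
    case (7 x b)
    then show ?case using *[of x b]
      by (auto simp: gf map_closed rack_closed fD(7)[symmetric])
  next
    case (8 x b)
    then show ?case using *[of x b]
      by (auto simp: gf map_closed rack_closed fD(8)[symmetric])
  qed (simp_all add: g_def)
  have fg: "f x (g x b) = b" if "x \<in> carrier X" "b \<in> carrier (grp N x)" for x b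
    using *[OF that] that by (auto simp: gf)
  show ?thesis
    unfolding isomorphism_def GLMod_def using f g
    by (auto simp: compose_def gf fg intro!: bexI[of _ g] restrict_ext)
qed

section \<open>Slice morphisms, abelian group objects and their category\<close>

lemma carrier_fibre_product [simp]:
  "carrier (total (S \<times>\<^sub>X T)) = fibre_carrier S T"
  by (simp add: fibre_product_def)

lemma fibre_carrier_iff [simp]:
  "(a, b) \<in> fibre_carrier S T \<longleftrightarrow>
     a \<in> carrier (total S) \<and> b \<in> carrier (total T) \<and> proj S a = proj T b"
  by (simp add: fibre_carrier_def)

lemma slice_homD:
  assumes "f \<in> slice_hom S T"
  shows "a \<in> carrier (total S) \<Longrightarrow> f a \<in> carrier (total T)"
    and "f \<in> extensional (carrier (total S))"
    and "\<lbrakk>a \<in> carrier (total S); b \<in> carrier (total S)\<rbrakk> \<Longrightarrow>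
           f (a \<star>\<^bsub>total S\<^esub> b) = f a \<star>\<^bsub>total T\<^esub> f b"
    and "a \<in> carrier (total S) \<Longrightarrow> f (\<u>\<^bsub>total S\<^esub> a) = \<u>\<^bsub>total T\<^esub> (f a)"
    and "a \<in> carrier (total S) \<Longrightarrow> f (\<d>\<^bsub>total S\<^esub> a) = \<d>\<^bsub>total T\<^esub> (f a)"
    and "a \<in> carrier (total S) \<Longrightarrow> proj T (f a) = proj S a"
  using assms GL_homD[of f "total S" "total T"] by (simp_all add: slice_hom_def)

lemma slice_homI:
  assumes "\<And>a. a \<in> carrier (total S) \<Longrightarrow> f a \<in> carrier (total T)"
    and "f \<in> extensional (carrier (total S))"
    and "\<And>a b. \<lbrakk>a \<in> carrier (total S); b \<in> carrier (total S)\<rbrakk> \<Longrightarrow>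
           f (a \<star>\<^bsub>total S\<^esub> b) = f a \<star>\<^bsub>total T\<^esub> f b"
    and "\<And>a. a \<in> carrier (total S) \<Longrightarrow> f (\<u>\<^bsub>total S\<^esub> a) = \<u>\<^bsub>total T\<^esub> (f a)"
    and "\<And>a. a \<in> carrier (total S) \<Longrightarrow> f (\<d>\<^bsub>total S\<^esub> a) = \<d>\<^bsub>total T\<^esub> (f a)"
    and "\<And>a. a \<in> carrier (total S) \<Longrightarrow> proj T (f a) = proj S a"
  shows "f \<in> slice_hom S T"
  using assms by (simp add: slice_hom_def GL_homI)

lemma ab_homD:
  assumes "f \<in> ab_hom G H"
  shows "f \<in> slice_hom (ob G) (ob H)"
    and "\<lbrakk>a \<in> carrier (total (ob G)); b \<in> carrier (total (ob G)); proj (ob G) a = proj (ob G) b\<rbrakk> \<Longrightarrow>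
           f (mu G (a, b)) = mu H (f a, f b)"
  using assms by (auto simp: ab_hom_def)

lemma ab_homI:
  assumes "f \<in> slice_hom (ob G) (ob H)"
    and "\<And>a b. \<lbrakk>a \<in> carrier (total (ob G)); b \<in> carrier (total (ob G)); proj (ob G) a = proj (ob G) b\<rbrakk> \<Longrightarrow>
           f (mu G (a, b)) = mu H (f a, f b)"
  shows "f \<in> ab_hom G H"
  using assms by (auto simp: ab_hom_def)

text \<open>Inside this locale the diagrams of an abelian group object become laws for elements with
  equal projections, so that later arguments need not pass through fibre products.\<close>

locale ab_object = GL_rack X for X :: "'x gl_rack" (structure) +
  fixes G :: "('y, 'x) gl_ab"
  assumes ab_obj: "G \<in> ab_obj X"
begin

abbreviation "S \<equiv> ob G"
abbreviation "T \<equiv> total S"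
abbreviation "p \<equiv> proj S"
abbreviation "zero \<equiv> unit G"

lemma slice: "S \<in> slice_obj X"
  using ab_obj by (simp add: ab_obj_def)

sublocale T: GL_rack T
  using slice by (simp add: slice_obj_def)

lemma p_hom: "p \<in> GL_hom T X"
  using slice by (simp add: slice_obj_def)

lemmas p_simps = GL_homD(1)[OF p_hom] GL_homD(3-5)[OF p_hom]

lemmas T_closed = T.op_closed T.u_closed T.d_closed

lemmas rack_closed = op_closed u_closed d_closed

lemma mu_hom: "mu G \<in> slice_hom (S \<times>\<^sub>X S) S"
  using ab_obj by (simp add: ab_obj_def)

lemma mu_closed:
  assumes "a \<in> carrier T" "b \<in> carrier T" "p a = p b"
  shows "mu G (a, b) \<in> carrier T" "p (mu G (a, b)) = p b"
    and "mu G (\<u>\<^bsub>T\<^esub> a, \<u>\<^bsub>T\<^esub> b) = \<u>\<^bsub>T\<^esub> (mu G (a, b))"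
    and "mu G (\<d>\<^bsub>T\<^esub> a, \<d>\<^bsub>T\<^esub> b) = \<d>\<^bsub>T\<^esub> (mu G (a, b))"
  using slice_homD(1,4,5,6)[OF mu_hom, of "(a, b)"] assms by (simp_all add: fibre_product_def)

text \<open>\<open>mu G\<close> is a rack homomorphism out of the fibre product, whose operation is
  componentwise. This interchange law yields \<open>op_decompose\<close> and the additivity of
  translations by zeros.\<close>

lemma mu_op:
  assumes "a \<in> carrier T" "b \<in> carrier T" "p a = p b" "c \<in> carrier T" "d \<in> carrier T" "p c = p d"
  shows "mu G (a \<star>\<^bsub>T\<^esub> c, b \<star>\<^bsub>T\<^esub> d) = mu G (a, b) \<star>\<^bsub>T\<^esub> mu G (c, d)"
  using slice_homD(3)[OF mu_hom, of "(a, b)" "(c, d)"] assms by (simp_all add: fibre_product_def)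

lemma zero_hom: "zero \<in> slice_hom (slice_terminal X) S"
  using ab_obj by (simp add: ab_obj_def)

text \<open>A slice morphism out of the terminal object is a section of \<open>p\<close> that is
  also a GL-rack homomorphism.\<close>

lemma zero_simps:
  "x \<in> carrier X \<Longrightarrow> zero x \<in> carrier T"
  "x \<in> carrier X \<Longrightarrow> p (zero x) = x"
  "x \<in> carrier X \<Longrightarrow> \<u>\<^bsub>T\<^esub> (zero x) = zero (\<u> x)"
  "x \<in> carrier X \<Longrightarrow> \<d>\<^bsub>T\<^esub> (zero x) = zero (\<d> x)"
  "\<lbrakk>x \<in> carrier X; y \<in> carrier X\<rbrakk> \<Longrightarrow> zero x \<star>\<^bsub>T\<^esub> zero y = zero (x \<star> y)"
  using slice_homD[OF zero_hom] by (simp_all add: slice_terminal_def)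

lemma neg_simps:
  assumes "a \<in> carrier T"
  shows "neg G a \<in> carrier T" "p (neg G a) = p a"
    and "mu G (neg G a, a) = zero (p a)"
  using ab_obj assms slice_homD(1,6)[of "neg G" S S a]
  by (simp_all add: ab_obj_def)

lemma mu_assoc:
  assumes "a \<in> carrier T" "b \<in> carrier T" "c \<in> carrier T" "p a = p b" "p b = p c"
  shows "mu G (mu G (a, b), c) = mu G (a, mu G (b, c))"
proof -
  have "((a, b), c) \<in> carrier (total (S \<times>\<^sub>X S \<times>\<^sub>X S))"
    using assms by (simp add: fibre_carrier_def) (simp add: fibre_product_def)
  then show ?thesis
    using ab_obj by (fastforce simp: ab_obj_def)
qed

lemma mu_comm:
  assumes "a \<in> carrier T" "b \<in> carrier T" "p a = p b"
  shows "mu G (a, b) = mu G (b, a)"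
  using ab_obj assms by (auto simp: ab_obj_def)

lemma mu_zero:
  assumes "a \<in> carrier T" "x = p a"
  shows "mu G (zero x, a) = a" "mu G (a, zero x) = a"
  using ab_obj assms by (auto simp: ab_obj_def)

end

lemma ab_objectI: "\<lbrakk>GL_rack X; G \<in> ab_obj X\<rbrakk> \<Longrightarrow> ab_object X G"
  by (simp add: ab_object_def ab_object_axioms_def)

lemma ab_hom_id:
  assumes "GL_rack X" "G \<in> ab_obj X"
  shows "(\<lambda>a \<in> carrier (total (ob G)). a) \<in> ab_hom G G"
proof -
  interpret ab_object X G using assms by (rule ab_objectI)
  show ?thesis
    by (intro ab_homI slice_homI) (simp_all add: T_closed mu_closed)
qed

lemma ab_hom_comp:
  assumes "GL_rack X" "G \<in> ab_obj X" and f: "f \<in> ab_hom G H" and g: "g \<in> ab_hom H K"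
  shows "compose (carrier (total (ob G))) g f \<in> ab_hom G K"
proof -
  interpret ab_object X G using assms(1,2) by (rule ab_objectI)
  show ?thesis
    by (intro ab_homI slice_homI)
      (simp_all add: compose_def T_closed mu_closed slice_homD[OF ab_homD(1)[OF f]]
        slice_homD[OF ab_homD(1)[OF g]] ab_homD(2)[OF f] ab_homD(2)[OF g])
qed

lemma is_category_Ab_slice:
  assumes "GL_rack X"
  shows "is_category (Ab_slice X)"
  unfolding is_category_def Ab_slice_def
proof (intro conjI ballI, unfold category.simps, goal_cases)
  case (3 G H f)
  note f = slice_homD(1,2)[OF ab_homD(1)[OF 3(3)]]
  then show ?case by (intro Id_compose) auto
next
  case (4 G H f)
  note f = slice_homD(1,2)[OF ab_homD(1)[OF 4(3)]]
  then show ?case by (intro compose_Id) auto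
next
  case (5 G H K L f g h)
  note f = slice_homD(1)[OF ab_homD(1)[OF 5(5)]]
  then show ?case by (intro compose_assoc) auto
qed (simp_all add: ab_hom_id[OF assms] ab_hom_comp[OF assms])

text \<open>The set-theoretic inverse respects all structure, by the argument of
  \<open>module_isomorphism\<close>. This serves the counit of the equivalence.\<close>

lemma ab_isomorphism:
  assumes "GL_rack X" "G \<in> ab_obj X" and f: "f \<in> ab_hom G H"
    and bij: "bij_betw f (carrier (total (ob G))) (carrier (total (ob H)))"
  shows "isomorphism (Ab_slice X) G H f"
proof -
  interpret ab_object X G using assms(1,2) by (rule ab_objectI)
  note fD = slice_homD[OF ab_homD(1)[OF f]] ab_homD(2)[OF f]
  define g where "g = (\<lambda>b \<in> carrier (total (ob H)). inv_into (carrier T) f b)"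
  have gf: "g (f a) = a" if "a \<in> carrier T" for a
    using that bij_betw_inv_into_left[OF bij] by (simp add: g_def fD)
  have *: "\<exists>a \<in> carrier T. b = f a" if "b \<in> carrier (total (ob H))" for b
    using that bij by (auto simp: bij_betw_def)
  have g: "g \<in> ab_hom H G"
  proof (intro ab_homI slice_homI, goal_cases)
    case (1 b)
    then show ?case using *[of b] gf by auto
  next
    case (3 a b)
    then show ?case using *[of a] *[of b] by (auto simp: gf T_closed fD(3)[symmetric])
  next
    case (4 b)
    then show ?case using *[of b] by (auto simp: gf T_closed fD(4)[symmetric])
  next
    case (5 b)
    then show ?case using *[of b] by (auto simp: gf T_closed fD(5)[symmetric])
  next
    case (6 b)
    then show ?case using *[of b] by (auto simp: gf fD(6))
  next
    case (7 a b)
    then show ?case using *[of a] *[of b] by (auto simp: gf mu_closed fD(6) fD(7)[symmetric])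
  qed (simp_all add: g_def)
  have fg: "f (g b) = b" if "b \<in> carrier (total (ob H))" for b
    using *[OF that] that by (auto simp: gf)
  show ?thesis
    unfolding isomorphism_def Ab_slice_def using f g
    by (auto simp: compose_def gf fg intro!: bexI[of _ g] restrict_ext)
qed

section \<open>From abelian group objects to modules\<close>

definition fibre :: "('y, 'x) gl_ab \<Rightarrow> 'x \<Rightarrow> 'y monoid" where
  "fibre G x = \<lparr>carrier = {a \<in> carrier (total (ob G)). proj (ob G) a = x},
                mult = (\<lambda>a b. mu G (a, b)), one = unit G x\<rparr>"

lemma fibre_simps [simp]:
  "a \<in> carrier (fibre G x) \<longleftrightarrow> a \<in> carrier (total (ob G)) \<and> proj (ob G) a = x"
  "a \<otimes>\<^bsub>fibre G x\<^esub> b = mu G (a, b)"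
  "\<one>\<^bsub>fibre G x\<^esub> = unit G x"
  by (simp_all add: fibre_def)

definition fibre_module :: "('y, 'x) gl_ab \<Rightarrow> ('x, 'y) gl_module" where
  "fibre_module G =
     \<lparr>grp = fibre G,
      phi = (\<lambda>x y a. a \<star>\<^bsub>total (ob G)\<^esub> unit G y),
      psi = (\<lambda>x y b. unit G x \<star>\<^bsub>total (ob G)\<^esub> b),
      zeta = (\<lambda>x. \<u>\<^bsub>total (ob G)\<^esub>),
      Omega = (\<lambda>x. \<d>\<^bsub>total (ob G)\<^esub>)\<rparr>"

lemma fibre_module_simps [simp]:
  "grp (fibre_module G) = fibre G"
  "phi (fibre_module G) x y a = a \<star>\<^bsub>total (ob G)\<^esub> unit G y"
  "psi (fibre_module G) x y b = unit G x \<star>\<^bsub>total (ob G)\<^esub> b"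
  "zeta (fibre_module G) x a = \<u>\<^bsub>total (ob G)\<^esub> a"
  "Omega (fibre_module G) x a = \<d>\<^bsub>total (ob G)\<^esub> a"
  by (simp_all add: fibre_module_def)

context ab_object
begin

lemma comm_group_fibre:
  assumes "x \<in> carrier X"
  shows "comm_group (fibre G x)"
proof (rule comm_groupI)
  show "\<exists>b \<in> carrier (fibre G x). b \<otimes>\<^bsub>fibre G x\<^esub> a = \<one>\<^bsub>fibre G x\<^esub>" if "a \<in> carrier (fibre G x)" for a
    using that by (intro bexI[of _ "neg G a"]) (simp_all add: neg_simps)
  show "a \<otimes>\<^bsub>fibre G x\<^esub> b = b \<otimes>\<^bsub>fibre G x\<^esub> a" if "a \<in> carrier (fibre G x)" "b \<in> carrier (fibre G x)" for a b
    using that by (simp add: mu_comm[of a])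
qed (use assms in \<open>simp_all add: mu_closed zero_simps mu_zero mu_assoc\<close>)

text \<open>Apply interchange to a = a + 0 and b = 0 + b, with zeros over \<open>p a\<close> and
  \<open>p b\<close>. Hence the operation of \<open>T\<close> can be recovered from
  \<open>phi\<close>, \<open>psi\<close> and the fibrewise addition.\<close>

lemma op_decompose:
  assumes "a \<in> carrier T" "b \<in> carrier T"
  shows "mu G (a \<star>\<^bsub>T\<^esub> zero (p b), zero (p a) \<star>\<^bsub>T\<^esub> b) = a \<star>\<^bsub>T\<^esub> b"
  using assms mu_op[of a "zero (p a)" "zero (p b)" b]
  by (simp add: p_simps zero_simps mu_zero)

text \<open>Unique division in \<open>T\<close> gives injectivity and a preimage. The preimage lies
  over x because its projection and x both solve the same division problem in X.\<close>

lemma translation_iso: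
  assumes x: "x \<in> carrier X" and y: "y \<in> carrier X"
  shows "(\<lambda>a. a \<star>\<^bsub>T\<^esub> zero y) \<in> iso (fibre G x) (fibre G (x \<star> y))"
proof -
  have inj: "a = b" if "a \<in> carrier T" "b \<in> carrier T" "a \<star>\<^bsub>T\<^esub> zero y = b \<star>\<^bsub>T\<^esub> zero y" for a b
    using that T.op_divisible[of "b \<star>\<^bsub>T\<^esub> zero y" "zero y"] y by (auto simp: T_closed zero_simps)
  have surj: "\<exists>a. a \<in> carrier T \<and> p a = x \<and> a \<star>\<^bsub>T\<^esub> zero y = b"
    if b: "b \<in> carrier T" "p b = x \<star> y" for b
  proof -
    obtain a where a: "a \<in> carrier T" "a \<star>\<^bsub>T\<^esub> zero y = b"
      using T.op_divisible[of b "zero y"] b y by (auto simp: zero_simps)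
    then have "p a \<star> y = x \<star> y"
      using b y p_simps(2)[of a "zero y"] by (simp add: zero_simps)
    then have "p a = x"
      using op_divisible[of "x \<star> y" y] op_closed a p_simps(1) x y by blast
    with a show ?thesis by blast
  qed
  have "bij_betw (\<lambda>a. a \<star>\<^bsub>T\<^esub> zero y) (carrier (fibre G x)) (carrier (fibre G (x \<star> y)))"
    unfolding bij_betw_def
  proof (intro conjI inj_onI equalityI subsetI)
    show "b \<in> (\<lambda>a. a \<star>\<^bsub>T\<^esub> zero y) ` carrier (fibre G x)" if "b \<in> carrier (fibre G (x \<star> y))" for b
      using surj[of b] that by force
  qed (use inj y in \<open>auto simp: T_closed p_simps zero_simps\<close>)
  \<comment> \<open>Additivity is interchange applied to \<open>zero y\<close> written as the sum of
    itself with itself.\<close>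
  moreover have "mu G (a, b) \<star>\<^bsub>T\<^esub> zero y = mu G (a \<star>\<^bsub>T\<^esub> zero y, b \<star>\<^bsub>T\<^esub> zero y)"
    if "a \<in> carrier T" "b \<in> carrier T" "p a = p b" for a b
    using that y by (simp add: mu_op zero_simps mu_zero)
  ultimately show ?thesis
    using y by (simp add: iso_def hom_def T_closed p_simps zero_simps)
qed

text \<open>\<open>M1\<close>, \<open>M2\<close> and \<open>M11\<close> come from distributivity in
  \<open>T\<close>, \<open>M3\<close> to \<open>M10\<close> from the compatibility of u and d with
  the operation, \<open>M12\<close> and \<open>M13\<close> from the square axioms. Where sums occur,
  \<open>op_decompose\<close> turns them back into products.\<close>

lemma fibre_module_obj: "fibre_module G \<in> module_obj X"
  unfolding module_obj_def
proof (rule CollectI, rule GL_module.intro[OF GL_rack_axioms GL_module_axioms.intro], goal_cases)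
  case (2 x y)
  then show ?case by (simp add: translation_iso fibre_module_def)
next
  case (3 x y)
  then show ?case
    \<comment> \<open>Since 0 + 0 = 0 over x, interchange makes left multiplication by
      \<open>zero x\<close> additive.\<close>
    using mu_op[of "zero x" "zero x"] by (simp add: hom_def zero_simps T_closed p_simps mu_zero)
next
  case (6 x y z a)
  then show ?case by (simp add: T.op_distrib[of a "zero y" "zero z"] zero_simps)
next
  case (7 x y z a)
  then show ?case by (simp add: T.op_distrib[of "zero x" a "zero z"] zero_simps)
next
  case (10 x y a)
  \<comment> \<open>Read backwards, \<open>zero_simps\<close> turns the zero over u y into u applied
    to \<open>zero y\<close>, where the axioms of \<open>T\<close> apply.\<close>
  then show ?case by (simp add: zero_simps(3)[symmetric] zero_simps(1) T.op_u)
next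
  case (11 x y a)
  then show ?case by (simp add: zero_simps(4)[symmetric] zero_simps(1) T.op_d)
next
  case (12 x y a)
  then show ?case by (simp add: zero_simps(3)[symmetric] zero_simps(1) T.u_op)
next
  case (13 x y a)
  then show ?case by (simp add: zero_simps(4)[symmetric] zero_simps(1) T.d_op)
next
  case (16 x y z a)
  \<comment> \<open>Write the zero over x * y as a product of zeros and distribute over a;
    \<open>op_decompose\<close> then splits the resulting product into the two summands of
    \<open>M11\<close>.\<close>
  then have "zero (x \<star> y) \<star>\<^bsub>T\<^esub> a = (zero x \<star>\<^bsub>T\<^esub> a) \<star>\<^bsub>T\<^esub> (zero y \<star>\<^bsub>T\<^esub> a)"
    by (simp add: zero_simps T.op_distrib flip: zero_simps(5))
  with 16 show ?case
    using op_decompose[of "zero x \<star>\<^bsub>T\<^esub> a" "zero y \<star>\<^bsub>T\<^esub> a"]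
    by (simp add: zero_simps p_simps T_closed)
next
  case (17 x b)
  \<comment> \<open>Here \<open>phi\<close> b + \<open>psi\<close> b is just b * b.\<close>
  then show ?case using op_decompose[of b b] by (simp add: T.ud_square)
next
  case (18 x b)
  then show ?case using op_decompose[of b b] by (simp add: T.du_square)
qed (auto simp: comm_group_fibre hom_def T_closed p_simps zero_simps mu_closed
    T.u_op T.d_op T.op_u T.op_d)

end

section \<open>The functor taking fibres\<close>

definition fibre_functor ::
    "'x gl_rack \<Rightarrow> (('y, 'x) gl_ab, 'y \<Rightarrow> 'y, ('x, 'y) gl_module, 'x \<Rightarrow> 'y \<Rightarrow> 'y) functr" where
  "fibre_functor X =
     \<lparr>on_obj = fibre_module,
      on_hom = (\<lambda>G H f. \<lambda>x \<in> carrier X. restrict f (carrier (fibre G x)))\<rparr>"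

text \<open>Morphisms are only required to respect \<open>mu\<close>, but on each fibre they are
  group homomorphisms, which preserve the identity.\<close>

lemma ab_hom_unit:
  assumes "GL_rack X" "G \<in> ab_obj X" "H \<in> ab_obj X" "f \<in> ab_hom G H" "x \<in> carrier X"
  shows "f (unit G x) = unit H x"
proof -
  interpret G: ab_object X G using assms by (intro ab_objectI)
  interpret H: ab_object X H using assms by (intro ab_objectI)
  have "f \<in> hom (fibre G x) (fibre H x)"
    using slice_homD[OF ab_homD(1)[OF assms(4)]] ab_homD(2)[OF assms(4)] by (auto simp: hom_def)
  from hom_one[OF this] show ?thesis
    using G.comm_group_fibre H.comm_group_fibre assms(5) by (simp add: comm_group_def)
qed

text \<open>Both \<open>phi\<close> and \<open>psi\<close> of \<open>fibre_module\<close> multiply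
  by a zero, so a morphism commutes with them because it preserves products and, by
  \<open>ab_hom_unit\<close>, zeros.\<close>

lemma is_functor_fibre_functor:
  assumes "GL_rack X"
  shows "is_functor (Ab_slice X) (GLMod X) (fibre_functor X)"
  unfolding is_functor_def Ab_slice_def GLMod_def fibre_functor_def
proof (intro conjI ballI, unfold category.simps functr.simps, goal_cases)
  case (1 G)
  then show ?case by (intro ab_object.fibre_module_obj ab_objectI assms)
next
  case (2 G H f)
  then interpret G: ab_object X G by (intro ab_objectI assms)
  note f = slice_homD[OF ab_homD(1)[OF 2(3)]] ab_homD(2)[OF 2(3)]
    ab_hom_unit[OF assms 2]
  show ?case
    by (rule module_homI)
      (simp_all add: f G.T_closed G.p_simps G.zero_simps G.mu_closed G.rack_closed)
next
  case (3 G)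
  then show ?case by (auto intro!: restrict_ext)
next
  case (4 G H K f g)
  then show ?case
    using slice_homD[OF ab_homD(1)[OF 4(4)]] by (auto simp: compose_def intro!: restrict_ext)
qed

section \<open>From modules to abelian group objects\<close>

text \<open>
  The total space of a module is a disjoint union of the \<open>A x\<close>, realised inside the universe
  \<open>'u\<close> by means of an injection \<open>pt\<close> of \<open>X \<times> 'u\<close> into \<open>'u\<close>.
\<close>

locale coded_GL_rack = GL_rack X for X :: "'x gl_rack" (structure) +
  fixes pt :: "'x \<Rightarrow> 'u \<Rightarrow> 'u"
  assumes inj_pt: "inj_on (case_prod pt) (carrier X \<times> UNIV)"
begin

text \<open>Together with \<open>coord\<close> this decodes \<open>pt\<close>. On elements that are
  not codes the values are unspecified.\<close>

definition base :: "'u \<Rightarrow> 'x" where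
  "base s = fst (inv_into (carrier X \<times> UNIV) (case_prod pt) s)"

definition coord :: "'u \<Rightarrow> 'u" where
  "coord s = snd (inv_into (carrier X \<times> UNIV) (case_prod pt) s)"

lemma base_coord_pt [simp]:
  assumes "x \<in> carrier X"
  shows "base (pt x a) = x" "coord (pt x a) = a"
  using inv_into_f_f[OF inj_pt, of "(x, a)"] assms by (simp_all add: base_def coord_def)

definition total_rack :: "('x, 'u) gl_module \<Rightarrow> 'u gl_rack" where
  "total_rack M =
     \<lparr>carrier = case_prod pt ` (SIGMA x : carrier X. carrier (grp M x)),
      rack_op = (\<lambda>s t. pt (base s \<star> base t)
        (phi M (base s) (base t) (coord s) \<otimes>\<^bsub>grp M (base s \<star> base t)\<^esub> psi M (base s) (base t) (coord t))),
      up = (\<lambda>s. pt (\<u> (base s)) (zeta M (base s) (coord s))),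
      down = (\<lambda>s. pt (\<d> (base s)) (Omega M (base s) (coord s)))\<rparr>"

lemma total_rack_simps [simp]:
  "s \<star>\<^bsub>total_rack M\<^esub> t = pt (base s \<star> base t)
     (phi M (base s) (base t) (coord s) \<otimes>\<^bsub>grp M (base s \<star> base t)\<^esub> psi M (base s) (base t) (coord t))"
  "\<u>\<^bsub>total_rack M\<^esub> s = pt (\<u> (base s)) (zeta M (base s) (coord s))"
  "\<d>\<^bsub>total_rack M\<^esub> s = pt (\<d> (base s)) (Omega M (base s) (coord s))"
  by (simp_all add: total_rack_def)

text \<open>The coding is injective on all of \<open>carrier X\<close> times \<open>UNIV\<close>, so
  a code determines its fibre and its coordinate, whether or not the coordinate belongs to the
  module.\<close>

lemma pt_mem [simp]:
  assumes "x \<in> carrier X"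
  shows "pt x a \<in> carrier (total_rack M) \<longleftrightarrow> a \<in> carrier (grp M x)"
proof
  assume "pt x a \<in> carrier (total_rack M)"
  then obtain y b where "y \<in> carrier X" "b \<in> carrier (grp M y)" "pt x a = pt y b"
    by (auto simp: total_rack_def)
  then show "a \<in> carrier (grp M x)"
    using assms base_coord_pt by metis
qed (use assms in \<open>force simp: total_rack_def\<close>)

lemma total_rack_mem:
  assumes "s \<in> carrier (total_rack M)"
  shows "base s \<in> carrier X" "coord s \<in> carrier (grp M (base s))" "pt (base s) (coord s) = s"
  using assms by (auto simp: total_rack_def)

text \<open>Each axiom is checked on bases, where it holds in X, and on coordinates, where it is the
  matching family of module laws: \<open>M1\<close>, \<open>M2\<close>, \<open>M11\<close> for
  distributivity, \<open>M12\<close>, \<open>M13\<close> for the squares, \<open>M3\<close> to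
  \<open>M10\<close> for u and d.\<close>

lemma GL_rack_total_rack:
  assumes "M \<in> module_obj X"
  shows "GL_rack (total_rack M)"
proof -
  interpret M: GL_module X "grp M" "phi M" "psi M" "zeta M" "Omega M"
    using assms by (rule module_objD)
  note closed = M.rack_closed M.A_closed M.map_closed
  show ?thesis
  proof (unfold_locales, goal_cases)
    case (2 s t)
    note s = total_rack_mem[OF 2(1)] and t = total_rack_mem[OF 2(2)]
    \<comment> \<open>The base of the quotient must be the quotient w of the bases. Its coordinate a
      must satisfy \<open>phi\<close> a + \<open>psi\<close> (\<open>coord t\<close>) =
      \<open>coord s\<close>, which has one solution because \<open>phi\<close> is
      bijective.\<close>
    obtain w where w: "w \<in> carrier X" "w \<star> base t = base s"
      using op_divisible[OF s(1) t(1)] by blast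
    have bij: "bij_betw (phi M w (base t)) (carrier (grp M w)) (carrier (grp M (base s)))"
      using M.phi_iso[OF w(1) t(1)] by (simp add: iso_def w)
    let ?q = "psi M w (base t) (coord t)"
    have q: "?q \<in> carrier (grp M (base s))"
      using M.map_closed(2)[OF w(1) t(1,2)] by (simp add: w)
    then have "coord s \<otimes>\<^bsub>grp M (base s)\<^esub> inv\<^bsub>grp M (base s)\<^esub> ?q \<in> carrier (grp M (base s))"
      using s by (simp add: closed)
    then obtain a where a: "a \<in> carrier (grp M w)"
      "phi M w (base t) a = coord s \<otimes>\<^bsub>grp M (base s)\<^esub> inv\<^bsub>grp M (base s)\<^esub> ?q"
      using bij by (force simp: bij_betw_def)
    interpret group "grp M (base s)" using s(1) by (rule M.fibre_group)
    have "z = pt w a" if z: "z \<in> carrier (total_rack M)" "z \<star>\<^bsub>total_rack M\<^esub> t = s" for z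
    proof -
      note z' = total_rack_mem[OF z(1)]
      have "base z \<star> base t = base s"
        using arg_cong[OF z(2), of base] z'(1) t(1) by (simp add: op_closed)
      then have bz: "base z = w"
        using z'(1) w op_divisible[OF s(1) t(1)] by blast
      have c: "phi M w (base t) (coord z) \<otimes>\<^bsub>grp M (base s)\<^esub> ?q = coord s"
        using arg_cong[OF z(2), of coord] s(1) by (simp add: bz w)
      have "phi M w (base t) (coord z) \<in> carrier (grp M (base s))"
        using bij z'(2) by (auto simp: bz bij_betw_def)
      then have "phi M w (base t) (coord z) = phi M w (base t) a"
        using q s(2) inv_solve_right[of _ "coord s" ?q] by (simp add: a c)
      then have "coord z = a"
        using bij a(1) z'(2) unfolding bz bij_betw_def by (blast dest: inj_onD)
      with z'(3) show ?thesis by (simp add: bz)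
    qed
    moreover have "pt w a \<star>\<^bsub>total_rack M\<^esub> t = s"
      using w(1) q s(2,3) by (simp add: w a m_assoc)
    ultimately show ?case
      using w(1) a(1) by (intro ex1I[of _ "pt w a"]) auto
  next
    case (3 r s t)
    note r = total_rack_mem[OF 3(1)] and s = total_rack_mem[OF 3(2)] and t = total_rack_mem[OF 3(3)]
    let ?x = "base r" and ?y = "base s" and ?z = "base t"
    \<comment> \<open>The maps indexed by x * z and y * z land in a fibre whose index is
      syntactically different from (x * y) * z. Rewriting with \<open>d\<close> places all summands
      in one group.\<close>
    have d: "(?x \<star> ?z) \<star> (?y \<star> ?z) = (?x \<star> ?y) \<star> ?z"
      using r s t by (simp add: op_distrib)
    note mult = M.map_mult(1)[of "?x \<star> ?z" "?y \<star> ?z", unfolded d]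
      M.map_mult(2)[of "?x \<star> ?z" "?y \<star> ?z", unfolded d]
    note cl = M.map_closed(1)[of "?x \<star> ?z" "?y \<star> ?z", unfolded d]
      M.map_closed(2)[of "?x \<star> ?z" "?y \<star> ?z", unfolded d]
    show ?case
      using r(1,2) s(1,2) t(1,2)
      by (simp add: closed d mult cl M.map_mult M.M1[of ?x ?y ?z] M.M2[of ?x ?y ?z]
          M.M11[of ?x ?y ?z] M.A_ac)
  next
    case (6 s)
    note s = total_rack_mem[OF 6]
    then show ?case by (simp add: closed M.M12 ud_square)
  next
    case (7 s)
    note s = total_rack_mem[OF 7]
    then show ?case by (simp add: closed M.M13 du_square)
  next
    case (8 s t)
    note st = total_rack_mem[OF 8(1)] total_rack_mem[OF 8(2)]
    then show ?case
      \<comment> \<open>Additivity of \<open>zeta\<close> splits u (s * t) into two summands,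
        matched by \<open>M3\<close> and \<open>M7\<close>.\<close>
      using M.map_mult(3)[of "base s \<star> base t"] by (simp add: closed M.M3 M.M7 u_op)
  next
    case (9 s t)
    note st = total_rack_mem[OF 9(1)] total_rack_mem[OF 9(2)]
    then show ?case
      using M.map_mult(4)[of "base s \<star> base t"] by (simp add: closed M.M4 M.M8 d_op)
  qed (use total_rack_mem[where M = M] in
      \<open>simp_all add: closed op_u op_d M.M5 M.M6 M.M9 M.M10\<close>)
qed

section \<open>Fibrewise addition on the total space\<close>

definition total_over :: "('x, 'u) gl_module \<Rightarrow> ('u, 'x) gl_over" where
  "total_over M = \<lparr>total = total_rack M, proj = restrict base (carrier (total_rack M))\<rparr>"

definition total_ab :: "('x, 'u) gl_module \<Rightarrow> ('u, 'x) gl_ab" where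
  "total_ab M =
     \<lparr>ob = total_over M,
      mu = (\<lambda>(s, t) \<in> fibre_carrier (total_over M) (total_over M).
        pt (base s) (coord s \<otimes>\<^bsub>grp M (base s)\<^esub> coord t)),
      unit = (\<lambda>x \<in> carrier X. pt x \<one>\<^bsub>grp M x\<^esub>),
      neg = (\<lambda>s \<in> carrier (total_rack M). pt (base s) (inv\<^bsub>grp M (base s)\<^esub> coord s))\<rparr>"

lemma total_over_simps [simp]:
  "total (total_over M) = total_rack M"
  "s \<in> carrier (total_rack M) \<Longrightarrow> proj (total_over M) s = base s"
  "proj (total_over M) \<in> extensional (carrier (total_rack M))"
  by (simp_all add: total_over_def)

lemma total_ab_simps [simp]:
  "ob (total_ab M) = total_over M"
  "\<lbrakk>s \<in> carrier (total_rack M); t \<in> carrier (total_rack M); base s = base t\<rbrakk> \<Longrightarrow>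
     mu (total_ab M) (s, t) = pt (base t) (coord s \<otimes>\<^bsub>grp M (base t)\<^esub> coord t)"
  "x \<in> carrier X \<Longrightarrow> unit (total_ab M) x = pt x \<one>\<^bsub>grp M x\<^esub>"
  "s \<in> carrier (total_rack M) \<Longrightarrow>
     neg (total_ab M) s = pt (base s) (inv\<^bsub>grp M (base s)\<^esub> coord s)"
  by (simp_all add: total_ab_def)

text \<open>Addition is a slice morphism because all structure maps are additive and the four
  summands of a product of sums can be rearranged in a commutative group. The group laws are
  inherited from the fibres.\<close>

lemma total_ab_obj:
  assumes "M \<in> module_obj X"
  shows "total_ab M \<in> ab_obj X"
proof -
  interpret M: GL_module X "grp M" "phi M" "psi M" "zeta M" "Omega M"
    using assms by (rule module_objD)
  interpret R: GL_rack "total_rack M"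
    using assms by (rule GL_rack_total_rack)
  note closed = M.rack_closed M.A_closed M.map_closed
  note mem = total_rack_mem[where M = M]
  note R_closed = R.op_closed R.u_closed R.d_closed
  \<comment> \<open>Elements of the fibre product are unpacked once and for all. The last fact
    places \<open>coord s\<close> in the group over \<open>base t\<close>, the index that remains
    after rewriting with the equality of bases.\<close>
  have pairE: thesis
    if "v \<in> fibre_carrier (total_over M) (total_over M)"
      and "\<And>s t. \<lbrakk>v = (s, t); s \<in> carrier (total_rack M); t \<in> carrier (total_rack M);
        base s = base t; coord s \<in> carrier (grp M (base t))\<rbrakk> \<Longrightarrow> thesis" for v thesis
  proof (cases v)
    case (Pair s t)
    with that(1) have "s \<in> carrier (total_rack M)" "t \<in> carrier (total_rack M)"
      "proj (total_over M) s = proj (total_over M) t"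
      by simp_all
    then show thesis
      using that(2)[OF Pair] mem(2)[of s] by simp
  qed
  have "total_over M \<in> slice_obj X"
    unfolding slice_obj_def
    by (intro CollectI conjI GL_homI)
      (use R.GL_rack_axioms R_closed in \<open>simp_all add: mem closed\<close>)
  moreover have "mu (total_ab M) \<in> slice_hom (total_over M \<times>\<^sub>X total_over M) (total_over M)"
  proof (rule slice_homI, unfold carrier_fibre_product, goal_cases)
    case (1 v)
    then show ?case by (elim pairE) (simp add: mem closed)
  next
    case 2
    show ?case by (simp add: total_ab_def)
  next
    case (3 v w)
    then show ?case
      by (elim pairE) (simp add: fibre_product_def mem closed M.map_mult M.A_ac)
  next
    case (4 v)
    then show ?case
      by (elim pairE) (simp add: fibre_product_def mem closed M.map_mult)
  next
    case (5 v)
    then show ?case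
      by (elim pairE) (simp add: fibre_product_def mem closed M.map_mult)
  next
    case (6 v)
    then show ?case
      by (elim pairE) (simp add: fibre_product_def mem closed)
  qed
  moreover have "unit (total_ab M) \<in> slice_hom (slice_terminal X) (total_over M)"
    by (rule slice_homI)
      (simp_all add: slice_terminal_def closed M.map_one total_ab_def
        monoid.l_one[OF M.fibre_group(3)])
  \<comment> \<open>Inversion respects the rack operation because inverting a sum is additive in a
    commutative group.\<close>
  moreover have "neg (total_ab M) \<in> slice_hom (total_over M) (total_over M)"
    by (rule slice_homI)
      (simp_all add: mem closed M.map_inv comm_group.inv_mult[OF M.grp], simp add: total_ab_def)
  moreover have "mu (total_ab M) (mu (total_ab M) (r, s), t) = mu (total_ab M) (r, mu (total_ab M) (s, t))"
    if "((r, s), t) \<in> carrier (total (total_over M \<times>\<^sub>X total_over M \<times>\<^sub>X total_over M))" for r s t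
  proof -
    from that have rs: "r \<in> carrier (total_rack M)" "s \<in> carrier (total_rack M)"
      "t \<in> carrier (total_rack M)" "proj (total_over M) r = proj (total_over M) s"
      and "proj (total_over M \<times>\<^sub>X total_over M) (r, s) = proj (total_over M) t"
      by simp_all
    then have "base r = base t" "base s = base t"
      by (simp_all add: fibre_product_def)
    with rs show ?thesis
      using mem(2)[of r] mem(2)[of s] by (simp add: mem closed M.A_ac)
  qed
  moreover have "mu (total_ab M) (unit (total_ab M) (base s), s) = s"
    "mu (total_ab M) (s, unit (total_ab M) (base s)) = s"
    "mu (total_ab M) (neg (total_ab M) s, s) = unit (total_ab M) (base s)"
    "mu (total_ab M) (s, neg (total_ab M) s) = unit (total_ab M) (base s)"
    if "s \<in> carrier (total_rack M)" for s
    using that by (simp_all add: mem closed monoid.l_one[OF M.fibre_group(3)]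
        monoid.r_one[OF M.fibre_group(3)] group.l_inv[OF M.fibre_group(1)] group.r_inv[OF M.fibre_group(1)])
  moreover have "mu (total_ab M) (s, t) = mu (total_ab M) (t, s)"
    if "s \<in> carrier (total_rack M)" "t \<in> carrier (total_rack M)" "base s = base t" for s t
    using that mem(2)[of s] mem(1)[of t] by (simp add: mem(2) M.A_ac(2)[of "base t" "coord s"])
  ultimately show ?thesis
    by (auto simp: ab_obj_def)
qed

section \<open>The functor taking total spaces\<close>

definition total_functor ::
    "(('x, 'u) gl_module, 'x \<Rightarrow> 'u \<Rightarrow> 'u, ('u, 'x) gl_ab, 'u \<Rightarrow> 'u) functr" where
  "total_functor =
     \<lparr>on_obj = total_ab,
      on_hom = (\<lambda>M N f. \<lambda>s \<in> carrier (total_rack M). pt (base s) (f (base s) (coord s)))\<rparr>"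

lemma is_functor_total_functor: "is_functor (GLMod X) (Ab_slice X) total_functor"
  unfolding is_functor_def Ab_slice_def GLMod_def total_functor_def
proof (intro conjI ballI, unfold category.simps functr.simps, goal_cases)
  case (1 M)
  then show ?case by (rule total_ab_obj)
next
  case (2 M N f)
  interpret M: GL_module X "grp M" "phi M" "psi M" "zeta M" "Omega M"
    using 2(1) by (rule module_objD)
  note f = module_homD[OF 2(3)]
  note simps = total_rack_mem[where M = M] f M.rack_closed M.A_closed M.map_closed
  show ?case
  proof (intro ab_homI slice_homI, goal_cases)
    case (7 s t)
    then have st: "s \<in> carrier (total_rack M)" "t \<in> carrier (total_rack M)" "base s = base t"
      by simp_all
    then show ?case
      using total_rack_mem(2)[of s M] by (simp add: simps)
  qed (simp_all add: simps)
next
  case (3 M)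
  then show ?case by (auto simp: total_rack_mem intro!: restrict_ext)
next
  case (4 M N P f g)
  then show ?case by (auto simp: total_rack_mem compose_def module_homD(1) intro!: restrict_ext)
qed

section \<open>Unit and counit of the equivalence\<close>

lemma fibre_total_mem [simp]:
  "s \<in> carrier (fibre (total_ab M) x) \<longleftrightarrow> s \<in> carrier (total_rack M) \<and> base s = x"
  by auto

text \<open>Coding commutes with \<open>phi\<close> and \<open>psi\<close> because multiplying by a
  zero of the total space adds the image of an identity element, which is again an identity. The
  inverse is \<open>coord\<close>.\<close>

lemma module_unit_isomorphism:
  assumes "M \<in> module_obj X"
  shows "isomorphism (GLMod X) M (fibre_module (total_ab M))
           (\<lambda>x \<in> carrier X. restrict (pt x) (carrier (grp M x)))"
proof (rule module_isomorphism[OF assms])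
  interpret M: GL_module X "grp M" "phi M" "psi M" "zeta M" "Omega M"
    using assms by (rule module_objD)
  note simps = M.rack_closed M.A_closed M.map_closed M.map_one
    monoid.l_one[OF M.fibre_group(3)] monoid.r_one[OF M.fibre_group(3)]
  show "(\<lambda>x \<in> carrier X. restrict (pt x) (carrier (grp M x)))
          \<in> module_hom X M (fibre_module (total_ab M))"
    \<comment> \<open>Without \<open>fibre_simps(1)\<close>, membership in a fibre of
      \<open>total_ab M\<close> is rewritten by \<open>fibre_total_mem\<close>, in terms of
      \<open>base\<close>.\<close>
    by (rule module_homI) (simp_all add: simps del: fibre_simps(1))
  show "bij_betw ((\<lambda>x \<in> carrier X. restrict (pt x) (carrier (grp M x))) x) (carrier (grp M x))
          (carrier (grp (fibre_module (total_ab M)) x))" if "x \<in> carrier X" for x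
    using that
    by (intro bij_betw_byWitness[of _ coord]) (auto simp: total_rack_mem simp del: fibre_simps(1))
qed

text \<open>A code over \<open>fibre_module G\<close> carries an element of \<open>G\<close>
  together with its own projection, so dropping the base loses nothing. By
  \<open>op_decompose\<close> the product of codes has the original product as its
  coordinate.\<close>

lemma ab_counit_isomorphism:
  assumes "G \<in> ab_obj X"
  shows "isomorphism (Ab_slice X) (total_ab (fibre_module G)) G
           (restrict coord (carrier (total_rack (fibre_module G))))"
proof (rule ab_isomorphism[OF GL_rack_axioms])
  interpret ab_object X G using GL_rack_axioms assms by (rule ab_objectI)
  note mem = total_rack_mem[where M = "fibre_module G", simplified]
  show "total_ab (fibre_module G) \<in> ab_obj X"
    by (intro total_ab_obj fibre_module_obj)
  show "restrict coord (carrier (total_rack (fibre_module G))) \<in> ab_hom (total_ab (fibre_module G)) G"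
  proof (intro ab_homI slice_homI, goal_cases)
    case (3 s t)
    then show ?case
      using op_decompose[of "coord s" "coord t"]
      by (simp add: mem rack_closed T_closed mu_closed p_simps zero_simps)
  next
    case (7 s t)
    then have "s \<in> carrier (total_rack (fibre_module G))" "t \<in> carrier (total_rack (fibre_module G))"
      "base s = base t"
      by simp_all
    then show ?case by (simp add: mem mu_closed)
  qed (simp_all add: mem rack_closed T_closed p_simps)
  show "bij_betw (restrict coord (carrier (total_rack (fibre_module G))))
          (carrier (total (ob (total_ab (fibre_module G))))) (carrier (total (ob G)))"
    by (intro bij_betw_byWitness[of _ "\<lambda>a. pt (p a) a"]) (auto simp: mem p_simps)
qed

lemma equivalent_categories_GLMod_Ab_slice:
  "equivalent_categories (GLMod X :: (('x, 'u) gl_module, _) category)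
     (Ab_slice X :: (('u, 'x) gl_ab, _) category)"
proof -
  have "natural_isomorphism (GLMod X) (GLMod X) id_functor (comp_functor (fibre_functor X) total_functor)
          (\<lambda>M. \<lambda>x \<in> carrier X. restrict (pt x) (carrier (grp M x)))"
    unfolding natural_isomorphism_def
  proof (intro conjI ballI, goal_cases)
    case (1 M)
    then show ?case
      using module_unit_isomorphism[of M]
      by (simp add: id_functor_def comp_functor_def fibre_functor_def total_functor_def GLMod_def)
  next
    case (2 M N f)
    then show ?case
      by (auto simp: id_functor_def comp_functor_def fibre_functor_def total_functor_def GLMod_def
          compose_def module_homD(1) simp del: fibre_simps(1) intro!: restrict_ext)
  qed
  moreover have "natural_isomorphism (Ab_slice X) (Ab_slice X)
      (comp_functor total_functor (fibre_functor X)) id_functor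
      (\<lambda>G. restrict coord (carrier (total_rack (fibre_module G))))"
    unfolding natural_isomorphism_def
  proof (intro conjI ballI, goal_cases)
    case (1 G)
    then show ?case
      using ab_counit_isomorphism[of G]
      by (simp add: id_functor_def comp_functor_def fibre_functor_def total_functor_def Ab_slice_def)
  next
    case (2 G H f)
    then have "f \<in> slice_hom (ob G) (ob H)"
      by (auto simp: Ab_slice_def dest: ab_homD(1))
    \<comment> \<open>As f preserves projections, \<open>f (coord s)\<close> stays in the fibre over
      \<open>base s\<close>, so its code is an element of the total space for \<open>H\<close> and
      decodes correctly.\<close>
    note f = slice_homD(1,6)[OF this]
    show ?case
      using total_rack_mem[where M = "fibre_module G"]
      by (auto simp: id_functor_def comp_functor_def fibre_functor_def total_functor_def Ab_slice_def
          compose_def f intro!: restrict_ext)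
  qed
  ultimately show ?thesis
    unfolding equivalent_categories_def
    using is_category_GLMod is_category_Ab_slice[OF GL_rack_axioms] is_functor_total_functor
      is_functor_fibre_functor[OF GL_rack_axioms]
    by blast
qed

end

section \<open>Room in the universe for the coding\<close>

lemma Times_lepoll_infinite:
  assumes "infinite (UNIV :: 'u set)" "A \<lesssim> (UNIV :: 'u set)"
  shows "A \<times> (UNIV :: 'u set) \<lesssim> (UNIV :: 'u set)"
proof -
  have "A \<times> (UNIV :: 'u set) \<lesssim> (UNIV :: 'u set) \<times> (UNIV :: 'u set)"
    using assms(2) by (intro times_lepoll_mono) auto
  \<comment> \<open>An infinite set is equipollent to its square.\<close>
  also have "\<dots> \<lesssim> (UNIV :: 'u set)"
    using card_of_Times_same_infinite[OF assms(1)]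
    by (intro eqpoll_imp_lepoll) (simp add: eqpoll_def card_of_ordIso)
  finally show ?thesis .
qed

theorem theorem7p4:
  fixes X :: "'x gl_rack"
  assumes "GL_rack X"
    and "infinite (UNIV :: 'u set)"
    and "carrier X \<lesssim> (UNIV :: 'u set)"
  shows "equivalent_categories
           (GLMod X :: (('x, 'u) gl_module, 'x \<Rightarrow> 'u \<Rightarrow> 'u) category)
           (Ab_slice X :: (('u, 'x) gl_ab, 'u \<Rightarrow> 'u) category)"
proof -
  \<comment> \<open>The two cardinality hypotheses enter only here, to supply the coding of
    pairs.\<close>
  obtain h :: "'x \<times> 'u \<Rightarrow> 'u" where "inj_on h (carrier X \<times> UNIV)"
    using Times_lepoll_infinite[OF assms(2,3)] by (auto simp: lepoll_def)
  then have "coded_GL_rack X (curry h)"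
    using assms(1) by (simp add: coded_GL_rack_def coded_GL_rack_axioms_def)
  then show ?thesis
    by (rule coded_GL_rack.equivalent_categories_GLMod_Ab_slice)
qed

end
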